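(* There exists a compactly supported smooth real-valued function in the unit disk, not identically zero, such that its periodic broken ray transform vanishes.
   Context: A periodic broken ray in the closed unit disk $M\subset\mathbb{R}^2$ is a periodic piecewise straight path in $M$ that is a straight line in the interior and is reflected at the boundary circle (the whole of which is reflecting) according to the usual reflection law (angle of incidence equals angle of reflection). Let $\Gamma$ be the set of all periodic broken rays. The periodic broken ray transform is the map taking a continuous $f:M\to\mathbb{R}$ to the function $\gamma\mapsto\int_{\operatorname{tr}(\gamma)}f\,d\mathcal{H}^1$ on $\Gamma$, where $\operatorname{tr}(\gamma)$ is the trace (image) of $\gamma$ and $\mathcal{H}^1$ is one-dimensional Hausdorff measure. *)

theory Defs
  imports "HOL-Analysis.Analysis"
begin

section \<open>One-dimensional Hausdorff measure\<close>

text \<open>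
  The one-dimensional Hausdorff measure in its usual normalisation, which needs no constant factor in
  dimension one. The covering sets are required to be bounded because \<^const>\<open>diameter\<close> carries no
  information about unbounded sets.
\<close>

definition hausdorff1_pre :: "real \<Rightarrow> 'a::metric_space set \<Rightarrow> ennreal" where
  "hausdorff1_pre \<delta> A =
     (INF U \<in> {U :: nat \<Rightarrow> 'a set. A \<subseteq> (\<Union>i. U i) \<and> (\<forall>i. bounded (U i) \<and> diameter (U i) \<le> \<delta>)}.
        \<Sum>i. ennreal (diameter (U i)))"

definition hausdorff1_outer :: "'a::metric_space set \<Rightarrow> ennreal" where
  "hausdorff1_outer A = (SUP \<delta> \<in> {0<..}. hausdorff1_pre \<delta> A)"

definition hausdorff1 :: "'a::metric_space measure" where
  "hausdorff1 = measure_of UNIV (sets borel) hausdorff1_outer"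

text \<open>
  \<^const>\<open>measure_of\<close> would collapse to the zero measure if \<^const>\<open>hausdorff1_outer\<close> were not
  countably additive on the Borel sets. The rest of this section excludes that, by
  Caratheodory's criterion for metric outer measures.
\<close>

lemma hausdorff1_pre_le:
  assumes "A \<subseteq> (\<Union>i. U i)" "\<And>i. bounded (U i)" "\<And>i. diameter (U i) \<le> \<delta>"
  shows "hausdorff1_pre \<delta> A \<le> (\<Sum>i. ennreal (diameter (U i)))"
  unfolding hausdorff1_pre_def using assms by (intro INF_lower) auto

lemma hausdorff1_pre_mono: "A \<subseteq> B \<Longrightarrow> hausdorff1_pre \<delta> A \<le> hausdorff1_pre \<delta> B"
  unfolding hausdorff1_pre_def by (rule INF_superset_mono) auto

lemma hausdorff1_pre_antimono: "\<delta> \<le> \<epsilon> \<Longrightarrow> hausdorff1_pre \<epsilon> A \<le> hausdorff1_pre \<delta> A"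
  unfolding hausdorff1_pre_def by (rule INF_superset_mono) (auto intro: order_trans)

lemma hausdorff1_pre_le_outer: "0 < \<delta> \<Longrightarrow> hausdorff1_pre \<delta> A \<le> hausdorff1_outer A"
  unfolding hausdorff1_outer_def by (rule SUP_upper) auto

lemma hausdorff1_outer_mono: "A \<subseteq> B \<Longrightarrow> hausdorff1_outer A \<le> hausdorff1_outer B"
  unfolding hausdorff1_outer_def by (intro SUP_mono) (auto intro: hausdorff1_pre_mono)

lemma hausdorff1_outer_empty [simp]: "hausdorff1_outer {} = 0"
proof -
  have "hausdorff1_pre \<delta> ({}::'a set) \<le> 0" if "0 < \<delta>" for \<delta> :: real
    using hausdorff1_pre_le[of "{}::'a set" "\<lambda>_. {}" \<delta>] that by simp
  then have "hausdorff1_outer ({}::'a set) \<le> 0"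
    unfolding hausdorff1_outer_def by (intro SUP_least) auto
  then show ?thesis by simp
qed

lemma hausdorff1_pre_subadditive:
  fixes A :: "nat \<Rightarrow> 'a::metric_space set"
  shows "hausdorff1_pre \<delta> (\<Union>n. A n) \<le> (\<Sum>n. hausdorff1_pre \<delta> (A n))"
proof (rule ennreal_le_epsilon)
  fix e :: real
  assume e: "0 < e" and fin: "(\<Sum>n. hausdorff1_pre \<delta> (A n)) < top"
  have "\<exists>U. A n \<subseteq> (\<Union>i. U i) \<and> (\<forall>i. bounded (U i) \<and> diameter (U i) \<le> \<delta>) \<and>
          (\<Sum>i. ennreal (diameter (U i))) < hausdorff1_pre \<delta> (A n) + ennreal (e * (1/2) ^ Suc n)" for n
  proof -
    have "hausdorff1_pre \<delta> (A n) < hausdorff1_pre \<delta> (A n) + ennreal (e * (1/2) ^ Suc n)"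
      using e fin by (auto simp: less_top dest!: ennreal_suminf_lessD)
    then show ?thesis
      by (subst (asm) (1) hausdorff1_pre_def) (auto simp: INF_less_iff)
  qed
  then obtain B where B: "\<And>n. A n \<subseteq> (\<Union>i. B n i)" "\<And>n i. bounded (B n i)"
      "\<And>n i. diameter (B n i) \<le> \<delta>"
      "\<And>n. (\<Sum>i. ennreal (diameter (B n i))) < hausdorff1_pre \<delta> (A n) + ennreal (e * (1/2) ^ Suc n)"
    by metis
  define C where "C = case_prod B \<circ> prod_decode"
  have "(\<Union>n. A n) \<subseteq> (\<Union>i. C i)"
    using B(1) by (auto simp: C_def subset_eq) (metis prod.case prod_encode_inverse)
  then have "hausdorff1_pre \<delta> (\<Union>n. A n) \<le> (\<Sum>i. ennreal (diameter (C i)))"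
    using B(2,3) by (intro hausdorff1_pre_le) (auto simp: C_def split: prod.split)
  also have "\<dots> = (\<Sum>n. \<Sum>i. ennreal (diameter (B n i)))"
    using suminf_ennreal_2dimen[of "\<lambda>n. \<Sum>i. ennreal (diameter (B n i))"
        "\<lambda>(n, i). ennreal (diameter (B n i))"]
    by (simp add: C_def case_prod_beta)
  also have "\<dots> \<le> (\<Sum>n. hausdorff1_pre \<delta> (A n) + ennreal (e * (1/2) ^ Suc n))"
    using B(4) by (intro suminf_le) (auto intro: less_imp_le)
  also have "\<dots> = (\<Sum>n. hausdorff1_pre \<delta> (A n)) + (\<Sum>n. ennreal (e * (1/2) ^ Suc n))"
    by (intro suminf_add[symmetric]) auto
  also have "(\<Sum>n. ennreal (e * (1/2) ^ Suc n)) = ennreal e"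
    using e sums_mult[OF power_half_series, of e] by (intro suminf_ennreal_eq) auto
  finally show "hausdorff1_pre \<delta> (\<Union>n. A n) \<le> (\<Sum>n. hausdorff1_pre \<delta> (A n)) + ennreal e" .
qed

lemma hausdorff1_outer_subadditive:
  "hausdorff1_outer (\<Union>n::nat. A n) \<le> (\<Sum>n. hausdorff1_outer (A n))"
proof -
  have "hausdorff1_pre \<delta> (\<Union>n. A n) \<le> (\<Sum>n. hausdorff1_outer (A n))" if "0 < \<delta>" for \<delta>
    by (rule order_trans[OF hausdorff1_pre_subadditive])
       (use that in \<open>auto intro!: suminf_le hausdorff1_pre_le_outer\<close>)
  then show ?thesis
    unfolding hausdorff1_outer_def[of "\<Union>n. A n"] by (intro SUP_least) auto
qed

lemma outer_measure_space_hausdorff1: "outer_measure_space UNIV hausdorff1_outer"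
  by (auto simp: outer_measure_space_def positive_def increasing_def countably_subadditive_def
      intro: hausdorff1_outer_mono hausdorff1_outer_subadditive)

lemma hausdorff1_outer_Un: "hausdorff1_outer (A \<union> B) \<le> hausdorff1_outer A + hausdorff1_outer B"
proof -
  have "hausdorff1_outer (\<Union>n. binaryset A B n) \<le> (\<Sum>n. hausdorff1_outer (binaryset A B n))"
    by (rule hausdorff1_outer_subadditive)
  then show ?thesis
    by (simp add: UN_binaryset_eq suminf_binaryset_eq)
qed

lemma hausdorff1_outer_separated:
  fixes A B :: "'a::metric_space set"
  assumes "0 < d" and d: "\<And>x y. x \<in> A \<Longrightarrow> y \<in> B \<Longrightarrow> d \<le> dist x y"
  shows "hausdorff1_outer A + hausdorff1_outer B \<le> hausdorff1_outer (A \<union> B)"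
proof -
  have *: "hausdorff1_pre \<delta> A + hausdorff1_pre \<delta> B \<le> hausdorff1_outer (A \<union> B)"
    if \<delta>: "0 < \<delta>" for \<delta>
  proof -
    define \<epsilon> where "\<epsilon> = min \<delta> (d/2)"
    have \<epsilon>: "0 < \<epsilon>" "\<epsilon> \<le> \<delta>" "\<epsilon> < d"
      using \<open>0 < d\<close> \<delta> by (auto simp: \<epsilon>_def)
    have "hausdorff1_pre \<epsilon> A + hausdorff1_pre \<epsilon> B \<le> (\<Sum>i. ennreal (diameter (U i)))"
      if U: "A \<union> B \<subseteq> (\<Union>i. U i)" "\<And>i. bounded (U i)" "\<And>i. diameter (U i) \<le> \<epsilon>" for U :: "nat \<Rightarrow> 'a set"
    proof -
      let ?V = "\<lambda>C i. if U i \<inter> C \<noteq> {} then U i else {}"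
      have V: "hausdorff1_pre \<epsilon> C \<le> (\<Sum>i. ennreal (diameter (?V C i)))" if "C \<subseteq> A \<union> B" for C
      proof (rule hausdorff1_pre_le)
        show "C \<subseteq> (\<Union>i. ?V C i)"
        proof
          fix x assume "x \<in> C"
          with that U(1) obtain i where "x \<in> U i" by blast
          with \<open>x \<in> C\<close> have "x \<in> ?V C i" by auto
          then show "x \<in> (\<Union>i. ?V C i)" by blast
        qed
      qed (use U \<epsilon> in auto)
      have le: "ennreal (diameter (?V A i)) + ennreal (diameter (?V B i)) \<le> ennreal (diameter (U i))" for i
      proof (cases "U i \<inter> A \<noteq> {} \<and> U i \<inter> B \<noteq> {}")
        case True
        then obtain x y where "x \<in> U i" "x \<in> A" "y \<in> U i" "y \<in> B" by auto
        then have "d \<le> diameter (U i)"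
          using d[of x y] diameter_bounded_bound[OF U(2), of x i y] by simp
        then show ?thesis using U(3)[of i] \<epsilon> by simp
      qed auto
      have "hausdorff1_pre \<epsilon> A + hausdorff1_pre \<epsilon> B \<le>
              (\<Sum>i. ennreal (diameter (?V A i))) + (\<Sum>i. ennreal (diameter (?V B i)))"
        by (intro add_mono V) auto
      also have "\<dots> = (\<Sum>i. ennreal (diameter (?V A i)) + ennreal (diameter (?V B i)))"
        by (intro suminf_add) auto
      also have "\<dots> \<le> (\<Sum>i. ennreal (diameter (U i)))"
        by (intro suminf_le le) auto
      finally show ?thesis .
    qed
    then have "hausdorff1_pre \<epsilon> A + hausdorff1_pre \<epsilon> B \<le> hausdorff1_pre \<epsilon> (A \<union> B)"
      unfolding hausdorff1_pre_def[of _ "A \<union> B"] by (intro INF_greatest) auto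
    also have "\<dots> \<le> hausdorff1_outer (A \<union> B)"
      using \<epsilon> by (intro hausdorff1_pre_le_outer)
    finally show ?thesis
      using add_mono[OF hausdorff1_pre_antimono[OF \<epsilon>(2), of A] hausdorff1_pre_antimono[OF \<epsilon>(2), of B]]
      by (rule order_trans[rotated])
  qed
  have "hausdorff1_outer A + hausdorff1_outer B =
          (SUP \<delta>\<in>{0<..}. hausdorff1_pre \<delta> A + hausdorff1_pre \<delta> B)"
    unfolding hausdorff1_outer_def
  proof (rule SUP_add_directed_ennreal[symmetric])
    fix i j :: real assume "i \<in> {0<..}" "j \<in> {0<..}"
    then show "\<exists>k\<in>{0<..}. hausdorff1_pre i A + hausdorff1_pre j B
        \<le> hausdorff1_pre k A + hausdorff1_pre k B"
      by (intro bexI[of _ "min i j"] add_mono hausdorff1_pre_antimono) auto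
  qed
  also have "\<dots> \<le> hausdorff1_outer (A \<union> B)"
    using * by (intro SUP_least) auto
  finally show ?thesis .
qed

lemma hausdorff1_outer_closed:
  fixes C X :: "'a::metric_space set"
  assumes "closed C"
  shows "hausdorff1_outer (X \<inter> C) + hausdorff1_outer (X - C) \<le> hausdorff1_outer X"
proof (cases "C = {} \<or> hausdorff1_outer X = top")
  case True
  then show ?thesis by auto
next
  case False
  then have ne: "C \<noteq> {}" and fin: "hausdorff1_outer X < top" by (auto simp: less_top)
  define R where "R k = {x \<in> X. 1 / real (k + 2) \<le> infdist x C \<and> infdist x C < 1 / real (k + 1)}" for k
  define Y where "Y n = {x \<in> X. 1 / real (n + 1) \<le> infdist x C}" for n
  have sep: "d \<le> dist x y" if "a + d \<le> infdist x C" "infdist y C \<le> a" for a d and x y :: 'a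
    using infdist_triangle[of x C y] that by simp
  have Y: "hausdorff1_outer (X \<inter> C) + hausdorff1_outer (Y n) \<le> hausdorff1_outer X" for n
  proof -
    have "hausdorff1_outer (Y n) + hausdorff1_outer (X \<inter> C) \<le> hausdorff1_outer (Y n \<union> (X \<inter> C))"
      by (rule hausdorff1_outer_separated[of "1 / real (n + 1)"])
         (auto simp: Y_def intro!: sep[of 0])
    also have "\<dots> \<le> hausdorff1_outer X"
      by (rule hausdorff1_outer_mono) (auto simp: Y_def)
    finally show ?thesis by (simp add: add.commute)
  qed
  have alt: "(\<Sum>k<n. hausdorff1_outer (R (2 * k + p))) \<le> hausdorff1_outer (\<Union>k<n. R (2 * k + p))" for n p
  proof (induction n)
    case (Suc n)
    show ?case
    proof (cases "n = 0")
      case False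
      let ?a = "1 / real (2 * n + p + 1)" and ?b = "1 / real (2 * n + p)"
      have "(\<Sum>k<Suc n. hausdorff1_outer (R (2 * k + p))) \<le>
          hausdorff1_outer (\<Union>k<n. R (2 * k + p)) + hausdorff1_outer (R (2 * n + p))"
        using Suc.IH by (simp add: add_right_mono)
      also have "\<dots> \<le> hausdorff1_outer ((\<Union>k<n. R (2 * k + p)) \<union> R (2 * n + p))"
      proof (rule hausdorff1_outer_separated[of "?b - ?a"])
        have "?a < ?b" using False by (intro frac_less2) auto
        then show "0 < ?b - ?a" by simp
        fix x y assume "x \<in> (\<Union>k<n. R (2 * k + p))" "y \<in> R (2 * n + p)"
        then obtain k where k: "k < n" "1 / real (2 * k + p + 2) \<le> infdist x C" "infdist y C < ?a"
          by (auto simp: R_def)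
        have "?b \<le> 1 / real (2 * k + p + 2)"
          using k(1) by (intro divide_left_mono) auto
        with k show "?b - ?a \<le> dist x y"
          by (intro sep[of ?a]) auto
      qed
      also have "(\<Union>k<n. R (2 * k + p)) \<union> R (2 * n + p) = (\<Union>k<Suc n. R (2 * k + p))"
        by (auto simp: lessThan_Suc)
      finally show ?thesis .
    qed auto
  qed simp
  have alt': "(\<Sum>k<n. hausdorff1_outer (R (2 * k + p))) \<le> hausdorff1_outer X" for n p
    by (rule order_trans[OF alt hausdorff1_outer_mono]) (auto simp: R_def)
  have split: "(\<Sum>k<2 * n. g k) = (\<Sum>k<n. g (2 * k + 0)) + (\<Sum>k<n. g (2 * k + 1))"
    for n and g :: "nat \<Rightarrow> ennreal"
    by (induction n) (auto simp: ac_simps)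
  have "(\<Sum>k<n. hausdorff1_outer (R k)) \<le> hausdorff1_outer X + hausdorff1_outer X" for n
  proof -
    have "(\<Sum>k<n. hausdorff1_outer (R k)) \<le> (\<Sum>k<2 * n. hausdorff1_outer (R k))"
      by (intro sum_mono2) auto
    also have "\<dots> \<le> hausdorff1_outer X + hausdorff1_outer X"
      unfolding split by (intro add_mono alt')
    finally show ?thesis .
  qed
  then have "(\<Sum>k. hausdorff1_outer (R k)) \<le> hausdorff1_outer X + hausdorff1_outer X"
    by (intro suminf_le_const) auto
  also have "\<dots> < top" using fin by simp
  finally have S: "(\<Sum>k. hausdorff1_outer (R k)) < top" .
  show ?thesis
  proof (rule ennreal_le_epsilon)
    fix e :: real assume e: "0 < e"
    define S where "S = (\<Sum>k. hausdorff1_outer (R k))"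
    have "(\<lambda>n. \<Sum>k<n. hausdorff1_outer (R k)) \<longlonglongrightarrow> S"
      unfolding S_def by (intro summable_LIMSEQ) auto
    then have "(\<lambda>n. (\<Sum>k<n. hausdorff1_outer (R k)) + ennreal e) \<longlonglongrightarrow> S + ennreal e"
      by (intro tendsto_add) auto
    moreover have "S < S + ennreal e"
      using S e by (auto simp: S_def less_top)
    ultimately have "\<forall>\<^sub>F n in sequentially. S < (\<Sum>k<n. hausdorff1_outer (R k)) + ennreal e"
      by (rule order_tendstoD(1))
    then obtain n where n: "S < (\<Sum>k<n. hausdorff1_outer (R k)) + ennreal e"
      by (auto simp: eventually_sequentially)
    let ?T = "\<Sum>k. hausdorff1_outer (R (k + n))"
    have Seq: "S = ?T + (\<Sum>k<n. hausdorff1_outer (R k))"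
      unfolding S_def by (intro suminf_offset) auto
    with n have T: "?T \<le> ennreal e"
      by (metis add.commute ennreal_add_left_cancel_less less_imp_le)
    have "X - C \<subseteq> Y n \<union> (\<Union>k. R (k + n))"
    proof
      fix x assume x: "x \<in> X - C"
      then have "infdist x C \<noteq> 0"
        using in_closed_iff_infdist_zero[OF \<open>closed C\<close> ne] by auto
      with infdist_nonneg[of x C] have pos: "0 < infdist x C" by linarith
      show "x \<in> Y n \<union> (\<Union>k. R (k + n))"
      proof (cases "1 / real (n + 1) \<le> infdist x C")
        case False
        define m where "m = (LEAST m. 1 / real (m + 1) \<le> infdist x C)"
        have "\<exists>m. 1 / real (m + 1) \<le> infdist x C"
          using reals_Archimedean[OF pos] by (auto simp: inverse_eq_divide intro: less_imp_le)
        then have m: "1 / real (m + 1) \<le> infdist x C"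
          unfolding m_def by (rule LeastI_ex)
        have "n < m"
        proof (rule ccontr)
          assume "\<not> n < m"
          then have "1 / real (n + 1) \<le> 1 / real (m + 1)"
            by (intro divide_left_mono) auto
          with m False show False by linarith
        qed
        then obtain k where k: "m = Suc (k + n)"
          by (metis less_iff_Suc_add add.commute)
        have "\<not> 1 / real (k + n + 1) \<le> infdist x C"
          using not_less_Least[of "k + n" "\<lambda>m. 1 / real (m + 1) \<le> infdist x C"] k
          by (simp add: m_def)
        with m x k have "x \<in> R (k + n)"
          by (auto simp: R_def ac_simps)
        then show ?thesis by blast
      qed (use x in \<open>auto simp: Y_def\<close>)
    qed
    then have "hausdorff1_outer (X - C) \<le> hausdorff1_outer (Y n) + hausdorff1_outer (\<Union>k. R (k + n))"
      by (rule order_trans[OF hausdorff1_outer_mono hausdorff1_outer_Un])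
    also have "\<dots> \<le> hausdorff1_outer (Y n) + ennreal e"
      using hausdorff1_outer_subadditive[of "\<lambda>k. R (k + n)"] T
      by (intro add_left_mono) (rule order_trans)
    finally have "hausdorff1_outer (X \<inter> C) + hausdorff1_outer (X - C) \<le>
        (hausdorff1_outer (X \<inter> C) + hausdorff1_outer (Y n)) + ennreal e"
      by (simp add: add.assoc add_left_mono)
    also have "\<dots> \<le> hausdorff1_outer X + ennreal e"
      by (intro add_right_mono Y)
    finally show "hausdorff1_outer (X \<inter> C) + hausdorff1_outer (X - C) \<le> hausdorff1_outer X + ennreal e" .
  qed
qed

lemma measure_space_hausdorff1:
  "measure_space UNIV (sets borel) (hausdorff1_outer :: 'a::metric_space set \<Rightarrow> ennreal)"
proof -
  interpret sigma_algebra "UNIV :: 'a set" UNIV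
    using sigma_algebra_Pow[of "UNIV :: 'a set"] by simp
  let ?L = "lambda_system UNIV UNIV (hausdorff1_outer :: 'a set \<Rightarrow> ennreal)"
  have ms: "measure_space UNIV ?L hausdorff1_outer"
    by (rule caratheodory_lemma[OF outer_measure_space_hausdorff1])
  have "C \<in> ?L" if "closed C" for C
  proof -
    have "hausdorff1_outer X \<le> hausdorff1_outer (X \<inter> C) + hausdorff1_outer (X - C)" for X
      using hausdorff1_outer_Un[of "X \<inter> C" "X - C"] by (simp add: Int_Diff_Un)
    then show ?thesis
      using hausdorff1_outer_closed[OF that] by (auto simp: lambda_system_eq intro: antisym)
  qed
  then have "sigma_sets UNIV (Collect closed) \<subseteq> ?L"
    using ms by (intro sigma_algebra.sigma_sets_subset) (auto simp: measure_space_def)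
  then have "sets borel \<subseteq> ?L"
    by (subst borel_eq_closed) simp
  then show ?thesis
    using ms sets.sigma_algebra_axioms[of "borel :: 'a measure"]
    by (auto simp: measure_space_def positive_def countably_additive_def)
qed

lemma space_hausdorff1 [simp]: "space hausdorff1 = UNIV"
  by (simp add: hausdorff1_def)

lemma sets_hausdorff1 [simp, measurable_cong]: "sets hausdorff1 = sets borel"
  unfolding hausdorff1_def using sets.sigma_sets_eq[of borel] by simp

lemma emeasure_hausdorff1: "A \<in> sets borel \<Longrightarrow> emeasure hausdorff1 A = hausdorff1_outer A"
  unfolding hausdorff1_def using measure_space_hausdorff1
  by (intro emeasure_measure_of_sigma) (auto simp: measure_space_def)


section \<open>Smooth functions\<close>

text \<open>Continuous with continuous directional derivatives up to order \<open>k\<close> on an open set \<open>S\<close>.\<close>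

fun times_cont_differentiable_on ::
    "nat \<Rightarrow> 'a::real_normed_vector set \<Rightarrow> ('a \<Rightarrow> 'b::real_normed_vector) \<Rightarrow> bool" where
  "times_cont_differentiable_on 0 S f \<longleftrightarrow> continuous_on S f"
| "times_cont_differentiable_on (Suc k) S f \<longleftrightarrow>
     (\<forall>x\<in>S. f differentiable (at x)) \<and>
     (\<forall>v. times_cont_differentiable_on k S (\<lambda>x. frechet_derivative f (at x) v))"

definition smooth_on :: "'a::real_normed_vector set \<Rightarrow> ('a \<Rightarrow> 'b::real_normed_vector) \<Rightarrow> bool" where
  "smooth_on S f \<longleftrightarrow> (\<forall>k. times_cont_differentiable_on k S f)"


section \<open>Broken rays in the closed unit disk\<close>

text \<open>The direction \<open>u\<close> after reflection in the line with unit normal \<open>n\<close>.\<close>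

definition reflect :: "'a::real_inner \<Rightarrow> 'a \<Rightarrow> 'a" where
  "reflect n u = u - (2 * (u \<bullet> n)) *\<^sub>R n"

text \<open>
  A broken ray is parametrised by arc length on the whole line, so at every time it has an incoming
  unit velocity \<open>u\<close> and an outgoing unit velocity \<open>w\<close> along which it runs straight for some time.
  These agree at interior points; at a boundary point \<open>\<gamma> t\<close>, which is its own outer unit normal, they
  are related by the reflection law.
\<close>

definition broken_ray :: "(real \<Rightarrow> real ^ 2) \<Rightarrow> bool" where
  "broken_ray \<gamma> \<longleftrightarrow>
     range \<gamma> \<subseteq> cball 0 1 \<and>
     (\<forall>t. \<exists>u w. \<exists>\<epsilon>>0. norm u = 1 \<and> norm w = 1 \<and>
        (\<forall>s\<in>{t - \<epsilon>..t}. \<gamma> s = \<gamma> t + (s - t) *\<^sub>R u) \<and>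
        (\<forall>s\<in>{t..t + \<epsilon>}. \<gamma> s = \<gamma> t + (s - t) *\<^sub>R w) \<and>
        (\<gamma> t \<in> ball 0 1 \<longrightarrow> w = u) \<and>
        (\<gamma> t \<in> sphere 0 1 \<longrightarrow> w = reflect (\<gamma> t) u))"

definition periodic_broken_rays :: "(real \<Rightarrow> real ^ 2) set" where
  "periodic_broken_rays = {\<gamma>. broken_ray \<gamma> \<and> (\<exists>T>0. \<forall>t. \<gamma> (t + T) = \<gamma> t)}"

definition periodic_broken_ray_transform :: "(real ^ 2 \<Rightarrow> real) \<Rightarrow> (real \<Rightarrow> real ^ 2) \<Rightarrow> real" where
  "periodic_broken_ray_transform f \<gamma> = (LINT x:range \<gamma>|hausdorff1. f x)"

end

theory Submission
  imports Defs
begin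

text \<open>
  The function is \<open>f x = x\<^sub>1 \<phi>(\<bar>x\<bar>\<^sup>2)\<close> with a smooth bump \<open>\<phi>\<close>; in polar coordinates it is
  \<open>a(r) cos \<theta>\<close>, a pure first Fourier mode. Such a function satisfies
  \<open>f (R x) + f (R\<^sup>-\<^sup>1 x) = 2 cos \<alpha> f x\<close> for the rotation \<open>R\<close> by the angle \<open>\<alpha>\<close>. If a set is invariant
  under \<open>R\<close>, then integrating this identity over it against a rotation-invariant measure gives
  \<open>2 I = 2 cos \<alpha> I\<close> for the integral \<open>I\<close> of \<open>f\<close>, so \<open>I = 0\<close> as soon as \<open>R\<close> is not the identity
  (\<open>integral_rotation_invariant_eq_0\<close>).

  The trace of a periodic broken ray is such a set (\<open>periodic_broken_ray_range_rotation\<close>). Suppose that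
  the ray leaves the boundary point \<open>b\<close> and hits the boundary next at \<open>c \<noteq> b\<close>. All chords of the ray
  meet the circle at the same angle, so the rotation \<open>R\<close> taking \<open>b\<close> to \<open>c\<close> also takes the outgoing
  velocity at \<open>b\<close> to the outgoing velocity at \<open>c\<close> (\<open>rotation_of_chord\<close>). A broken ray is determined
  by its position and outgoing velocity (\<open>broken_ray_deterministic\<close>), and rotating a broken ray gives
  a broken ray. Hence with the chord length \<open>l\<close> the rays \<open>t \<mapsto> \<gamma> (t + l)\<close> and \<open>t \<mapsto> R (\<gamma> t)\<close> agree
  from \<open>b\<close> onwards. By periodicity they agree for all times, so the trace is invariant under \<open>R\<close>.
\<close>


section \<open>Smooth functions with compact support\<close>

text \<open>
  The Frechet derivative is a choice made by \<^const>\<open>frechet_derivative\<close>; in inductions on the order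
  of differentiability it is more convenient to supply or receive any function that is the derivative.
\<close>
lemma times_cont_differentiable_SucI:
  fixes f :: "'a::real_normed_vector \<Rightarrow> 'b::real_normed_vector"
  assumes "\<And>x. (f has_derivative f' x) (at x)"
    and "\<And>v. times_cont_differentiable_on k UNIV (\<lambda>x. f' x v)"
  shows "times_cont_differentiable_on (Suc k) UNIV f"
proof -
  have "frechet_derivative f (at x) = f' x" for x
    using assms(1) by (metis frechet_derivative_at)
  with assms show ?thesis by (auto simp: differentiable_def)
qed

lemma times_cont_differentiable_Suc_iff:
  fixes f :: "'a::real_normed_vector \<Rightarrow> 'b::real_normed_vector"
  shows "times_cont_differentiable_on (Suc k) UNIV f \<longleftrightarrow>
    (\<exists>f'. (\<forall>x. (f has_derivative f' x) (at x)) \<and>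
          (\<forall>v. times_cont_differentiable_on k UNIV (\<lambda>x. f' x v)))"
proof
  assume "times_cont_differentiable_on (Suc k) UNIV f"
  then show "\<exists>f'. (\<forall>x. (f has_derivative f' x) (at x)) \<and>
      (\<forall>v. times_cont_differentiable_on k UNIV (\<lambda>x. f' x v))"
    by (intro exI[of _ "\<lambda>x. frechet_derivative f (at x)"]) (simp add: frechet_derivative_works)
next
  assume "\<exists>f'. (\<forall>x. (f has_derivative f' x) (at x)) \<and>
      (\<forall>v. times_cont_differentiable_on k UNIV (\<lambda>x. f' x v))"
  then obtain f' where "\<And>x. (f has_derivative f' x) (at x)"
    and "\<And>v. times_cont_differentiable_on k UNIV (\<lambda>x. f' x v)"
    by blast
  then show "times_cont_differentiable_on (Suc k) UNIV f"
    by (rule times_cont_differentiable_SucI)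
qed

lemma times_cont_differentiable_Suc_imp:
  "times_cont_differentiable_on (Suc k) UNIV f \<Longrightarrow> times_cont_differentiable_on k UNIV f"
proof (induction k arbitrary: f)
  case 0
  then show ?case
    by (auto intro!: continuous_at_imp_continuous_on differentiable_imp_continuous_within)
next
  case (Suc k)
  obtain f' where "\<And>x. (f has_derivative f' x) (at x)"
    and "\<And>v. times_cont_differentiable_on (Suc k) UNIV (\<lambda>x. f' x v)"
    using Suc.prems unfolding times_cont_differentiable_Suc_iff[of "Suc k"] by blast
  then show ?case
    by (intro times_cont_differentiable_SucI[of f f'] Suc.IH)
qed

lemma times_cont_differentiable_const:
  "times_cont_differentiable_on k UNIV (\<lambda>x. c)"
proof (induction k arbitrary: c)
  case (Suc k)
  show ?case
    by (rule times_cont_differentiable_SucI[OF has_derivative_const Suc])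
qed simp

lemma times_cont_differentiable_bounded_linear:
  assumes "bounded_linear f"
  shows "times_cont_differentiable_on k UNIV f"
proof (cases k)
  case 0
  then show ?thesis using linear_continuous_on[OF assms] by simp
next
  case (Suc j)
  show ?thesis
    unfolding Suc
    by (rule times_cont_differentiable_SucI[OF bounded_linear_imp_has_derivative[OF assms]
          times_cont_differentiable_const])
qed

lemma times_cont_differentiable_add:
  "times_cont_differentiable_on k UNIV f \<Longrightarrow> times_cont_differentiable_on k UNIV g \<Longrightarrow>
   times_cont_differentiable_on k UNIV (\<lambda>x. f x + g x)"
proof (induction k arbitrary: f g)
  case (Suc k)
  obtain f' where f': "\<And>x. (f has_derivative f' x) (at x)"
    "\<And>v. times_cont_differentiable_on k UNIV (\<lambda>x. f' x v)"
    using Suc.prems(1) unfolding times_cont_differentiable_Suc_iff by blast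
  obtain g' where g': "\<And>x. (g has_derivative g' x) (at x)"
    "\<And>v. times_cont_differentiable_on k UNIV (\<lambda>x. g' x v)"
    using Suc.prems(2) unfolding times_cont_differentiable_Suc_iff by blast
  show ?case
    by (rule times_cont_differentiable_SucI[OF has_derivative_add[OF f'(1) g'(1)]])
       (rule Suc.IH[OF f'(2) g'(2)])
qed (auto intro: continuous_on_add)

lemma times_cont_differentiable_mult:
  fixes f g :: "'a::real_normed_vector \<Rightarrow> 'b::real_normed_algebra"
  shows "times_cont_differentiable_on k UNIV f \<Longrightarrow> times_cont_differentiable_on k UNIV g \<Longrightarrow>
   times_cont_differentiable_on k UNIV (\<lambda>x. f x * g x)"
proof (induction k arbitrary: f g)
  case (Suc k)
  obtain f' where f': "\<And>x. (f has_derivative f' x) (at x)"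
    "\<And>v. times_cont_differentiable_on k UNIV (\<lambda>x. f' x v)"
    using Suc.prems(1) unfolding times_cont_differentiable_Suc_iff by blast
  obtain g' where g': "\<And>x. (g has_derivative g' x) (at x)"
    "\<And>v. times_cont_differentiable_on k UNIV (\<lambda>x. g' x v)"
    using Suc.prems(2) unfolding times_cont_differentiable_Suc_iff by blast
  show ?case
  proof (rule times_cont_differentiable_SucI)
    show "((\<lambda>x. f x * g x) has_derivative (\<lambda>v. f x * g' x v + f' x v * g x)) (at x)" for x
      by (rule has_derivative_mult[OF f'(1) g'(1)])
    show "times_cont_differentiable_on k UNIV (\<lambda>x. f x * g' x v + f' x v * g x)" for v
      using Suc.prems[THEN times_cont_differentiable_Suc_imp] f'(2) g'(2)
      by (intro times_cont_differentiable_add Suc.IH)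
  qed
qed (auto intro: continuous_on_mult)

text \<open>
  The outer function comes with the sequence \<open>D\<close> of its iterated derivatives. The induction needs the
  claim for all of them, because differentiating \<open>D n \<circ> g\<close> produces \<open>D (n + 1) \<circ> g\<close>.
\<close>
lemma times_cont_differentiable_compose:
  fixes D :: "nat \<Rightarrow> real \<Rightarrow> real" and g :: "'a::real_normed_vector \<Rightarrow> real"
  assumes D: "\<And>n t. (D n has_real_derivative D (Suc n) t) (at t)"
  shows "times_cont_differentiable_on k UNIV g \<Longrightarrow>
    times_cont_differentiable_on k UNIV (\<lambda>x. D n (g x))"
proof (induction k arbitrary: n)
  case 0
  have "continuous_on UNIV (D n)"
    using D DERIV_continuous_on[of UNIV "D n"] by blast
  then show ?case
    using 0 by (auto intro: continuous_on_compose2)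
next
  case (Suc k)
  obtain g' where g': "\<And>x. (g has_derivative g' x) (at x)"
    "\<And>v. times_cont_differentiable_on k UNIV (\<lambda>x. g' x v)"
    using Suc.prems unfolding times_cont_differentiable_Suc_iff by blast
  show ?case
  proof (rule times_cont_differentiable_SucI)
    show "((\<lambda>x. D n (g x)) has_derivative (\<lambda>v. D (Suc n) (g x) * g' x v)) (at x)" for x
      using has_derivative_compose[OF g'(1) D[unfolded has_field_derivative_def]] .
    show "times_cont_differentiable_on k UNIV (\<lambda>x. D (Suc n) (g x) * g' x v)" for v
      using Suc.prems[THEN times_cont_differentiable_Suc_imp] g'(2)
      by (intro times_cont_differentiable_mult Suc.IH)
  qed
qed

text \<open>
  These are the functions to which differentiation leads from \<open>exp (- 1 / t)\<close>. The whole family is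
  needed because it is closed under differentiation and hence yields all derivatives at once.
\<close>
definition flat :: "real poly \<Rightarrow> real \<Rightarrow> real" where
  "flat p t = (if t \<le> 0 then 0 else poly p (1 / t) * exp (- (1 / t)))"

lemma tendsto_poly_times_exp_minus:
  "((\<lambda>y. poly p y * exp (- y)) \<longlongrightarrow> 0) at_top" for p :: "real poly"
proof -
  have "((\<lambda>y. \<Sum>i\<le>degree p. coeff p i * (y ^ i / exp y)) \<longlongrightarrow> (\<Sum>i\<le>degree p. coeff p i * 0)) at_top"
    by (intro tendsto_intros tendsto_power_div_exp_0)
  then show ?thesis
    by (simp add: poly_altdef sum_distrib_right exp_minus divide_inverse mult.assoc)
qed

text \<open>
  For \<open>t > 0\<close> the chain rule with \<open>(1 / t)' = - 1 / t\<^sup>2\<close> gives the polynomial \<open>X\<^sup>2 (p - p')\<close>. At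
  \<open>0\<close> the difference quotient is \<open>y p(y) exp (- y)\<close> with \<open>y = 1 / h \<rightarrow> \<infinity>\<close>, which vanishes in the limit
  because the exponential beats every polynomial.
\<close>
lemma flat_has_derivative:
  "(flat p has_real_derivative flat (monom 1 2 * (p - pderiv p)) t) (at t)"
proof (cases t "0 :: real" rule: linorder_cases)
  case less
  have "((\<lambda>_. 0) has_real_derivative flat (monom 1 2 * (p - pderiv p)) t) (at t)"
    using less by (auto simp: flat_def)
  then show ?thesis
    by (rule DERIV_cong_ev[THEN iffD1, rotated 3])
       (use less in \<open>auto simp: flat_def intro!: eventually_mono[OF eventually_nhds_in_open[of "{..<0}"]]\<close>)
next
  case equal
  have "((\<lambda>h. poly (pCons 0 p) (1 / h) * exp (- (1 / h))) \<longlongrightarrow> 0) (at_right (0::real))"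
    using filterlim_compose[OF tendsto_poly_times_exp_minus[of "pCons 0 p"] filterlim_inverse_at_top_right]
    unfolding inverse_eq_divide .
  then have "((\<lambda>h. flat p h / h) \<longlongrightarrow> 0) (at_right 0)"
    by (rule Lim_transform_eventually)
       (auto simp: flat_def eventually_at_filter)
  moreover have "((\<lambda>h. flat p h / h) \<longlongrightarrow> 0) (at_left 0)"
    by (rule Lim_transform_eventually[OF tendsto_const])
       (auto simp: flat_def eventually_at_filter)
  ultimately have "((\<lambda>h. flat p h / h) \<longlongrightarrow> 0) (at 0)"
    by (simp add: filterlim_split_at)
  then show ?thesis
    using equal by (simp add: DERIV_def flat_def)
next
  case greater
  have "((\<lambda>t. poly p (1 / t) * exp (- (1 / t))) has_real_derivative
      flat (monom 1 2 * (p - pderiv p)) t) (at t)"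
    using greater
    by (auto intro!: derivative_eq_intros DERIV_chain2[OF poly_DERIV]
        simp: flat_def poly_monom field_simps power2_eq_square)
  then show ?thesis
    by (rule DERIV_cong_ev[THEN iffD1, rotated 3])
       (use greater in \<open>auto simp: flat_def intro!: eventually_mono[OF eventually_nhds_in_open[of "{0<..}"]]\<close>)
qed

lemma smooth_flat_compose:
  assumes "smooth_on UNIV g"
  shows "smooth_on UNIV (\<lambda>x. flat p (g x))"
proof -
  define D where "D n = flat (((\<lambda>q. monom 1 2 * (q - pderiv q)) ^^ n) p)" for n
  have "(D n has_real_derivative D (Suc n) t) (at t)" for n t
    unfolding D_def using flat_has_derivative by simp
  moreover have "times_cont_differentiable_on k UNIV g" for k
    using assms by (simp add: smooth_on_def)
  ultimately have "times_cont_differentiable_on k UNIV (\<lambda>x. D 0 (g x))" for k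
    by (rule times_cont_differentiable_compose)
  then show ?thesis by (simp add: D_def smooth_on_def)
qed

text \<open>
  The number \<open>1 / 4\<close> puts the support into the disk of radius \<open>1 / 2\<close>. The factor \<^term>\<open>x $ 1\<close>
  turns a radial bump into a function of angular frequency one.
\<close>
definition odd_bump :: "real ^ 2 \<Rightarrow> real" where
  "odd_bump x = x $ 1 * flat 1 (1 / 4 - x \<bullet> x)"

lemma smooth_odd_bump: "smooth_on UNIV odd_bump"
proof -
  have lin: "times_cont_differentiable_on k UNIV (\<lambda>x :: real ^ 2. x $ i)" for k i
    by (intro times_cont_differentiable_bounded_linear bounded_linear_vec_nth)
  have "times_cont_differentiable_on k UNIV (\<lambda>x :: real ^ 2. 1 / 4 + (- 1) * (x $ 1 * x $ 1 + x $ 2 * x $ 2))" for k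
    by (intro times_cont_differentiable_add times_cont_differentiable_mult
        times_cont_differentiable_const lin)
  then have "smooth_on UNIV (\<lambda>x :: real ^ 2. 1 / 4 - x \<bullet> x)"
    by (simp add: smooth_on_def inner_vec_def sum_2 algebra_simps)
  from smooth_flat_compose[OF this, of 1] show ?thesis
    unfolding smooth_on_def odd_bump_def[abs_def]
    by (intro allI times_cont_differentiable_mult lin) auto
qed

section \<open>Integrals over rotation-invariant sets\<close>

definition rotation :: "real \<Rightarrow> real ^ 2 \<Rightarrow> real ^ 2" where
  "rotation a x = vector [cos a * x $ 1 - sin a * x $ 2, sin a * x $ 1 + cos a * x $ 2]"

lemma rotation_nth [simp]:
  "rotation a x $ 1 = cos a * x $ 1 - sin a * x $ 2"
  "rotation a x $ 2 = sin a * x $ 1 + cos a * x $ 2"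
  by (simp_all add: rotation_def)

lemma orthogonal_transformation_rotation: "orthogonal_transformation (rotation a)"
proof -
  have "linear (rotation a)"
    by (rule linearI) (simp_all add: vec_eq_iff forall_2 algebra_simps)
  moreover have "rotation a x \<bullet> rotation a y = x \<bullet> y" for x y
  proof -
    have "rotation a x \<bullet> rotation a y =
        (cos a * cos a + sin a * sin a) * (x $ 1 * y $ 1 + x $ 2 * y $ 2)"
      unfolding inner_vec_def sum_2 rotation_nth inner_real_def
      by (simp add: algebra_simps del: sin_cos_squared_add3)
    then show ?thesis
      using sin_cos_squared_add3[of a] by (simp add: inner_vec_def sum_2)
  qed
  ultimately show ?thesis by (simp add: orthogonal_transformation_def)
qed

lemma rotation_minus_cancel [simp]: "rotation (- a) (rotation a x) = x"
proof -
  have "rotation (- a) (rotation a x) $ i = (cos a * cos a + sin a * sin a) * x $ i"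
    if "i = 1 \<or> i = 2" for i
    using that by (auto simp: algebra_simps simp del: sin_cos_squared_add3)
  then show ?thesis
    by (simp add: vec_eq_iff forall_2 del: rotation_nth)
qed

lemma diameter_image_isometry:
  assumes "\<And>x y. dist (R x) (R y) = dist x y"
  shows "diameter (R ` U) = diameter U"
proof -
  have "(\<lambda>(x, y). dist x y) ` (R ` U \<times> R ` U) = (\<lambda>(x, y). dist x y) ` (U \<times> U)"
    using assms by (force simp: image_iff)
  then show ?thesis
    unfolding diameter_def by simp
qed

lemma hausdorff1_outer_image_isometry_le:
  assumes R: "\<And>x y. dist (R x) (R y) = dist x y"
  shows "hausdorff1_outer (R ` A) \<le> hausdorff1_outer A"
proof -
  have "hausdorff1_pre \<delta> (R ` A) \<le> hausdorff1_pre \<delta> A" for \<delta>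
    unfolding hausdorff1_pre_def[of \<delta> A]
  proof (rule INF_greatest, clarify)
    fix U :: "nat \<Rightarrow> 'a set"
    assume U: "A \<subseteq> (\<Union>i. U i)" "\<forall>i. bounded (U i) \<and> diameter (U i) \<le> \<delta>"
    have "bounded (R ` U i)" for i
      using U(2) R unfolding bounded_def by (metis (no_types, lifting) imageE)
    then have "hausdorff1_pre \<delta> (R ` A) \<le> (\<Sum>i. ennreal (diameter (R ` U i)))"
      using U by (intro hausdorff1_pre_le) (auto simp: diameter_image_isometry[OF R] simp flip: image_UN)
    then show "hausdorff1_pre \<delta> (R ` A) \<le> (\<Sum>i. ennreal (diameter (U i)))"
      by (simp add: diameter_image_isometry[OF R])
  qed
  then show ?thesis
    unfolding hausdorff1_outer_def by (intro SUP_mono) blast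
qed

text \<open>
  An isometry carries covers to covers of the same diameters, so it cannot increase the outer measure.
  The same holds for its inverse, whence equality. Surjectivity is expressed by a right inverse.
\<close>
lemma distr_hausdorff1_isometry:
  fixes R :: "'a::metric_space \<Rightarrow> 'a"
  assumes R: "\<And>x y. dist (R x) (R y) = dist x y" and "\<And>x. R (R' x) = x"
  shows "distr hausdorff1 borel R = (hausdorff1 :: 'a measure)"
proof (rule measure_eqI)
  have "continuous_on UNIV R"
    using R by (metis continuous_on_iff)
  then have meas: "R \<in> borel \<rightarrow>\<^sub>M borel"
    by (rule borel_measurable_continuous_onI)
  fix A assume "A \<in> sets (distr hausdorff1 borel R)"
  then have A: "A \<in> sets borel" by simp
  have vimage: "R -` A = R' ` A"
  proof -
    have "R' (R x) = x" for x
      using R[of "R' (R x)" x] assms(2) by simp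
    then have "x \<in> R' ` A" if "R x \<in> A" for x
      using that by (metis imageI)
    then show ?thesis using assms(2) by auto
  qed
  have R': "dist (R' x) (R' y) = dist x y" for x y
    using R[of "R' x" "R' y"] assms(2) by simp
  have "R ` R' ` A = A" using assms(2) by (simp add: image_image)
  then have "hausdorff1_outer (R' ` A) = hausdorff1_outer A"
    using hausdorff1_outer_image_isometry_le[OF R, of "R' ` A"]
      hausdorff1_outer_image_isometry_le[OF R', of A] by simp
  moreover have "R -` A \<in> sets borel"
    using measurable_sets[OF meas A] by simp
  ultimately show "emeasure (distr hausdorff1 borel R) A = emeasure hausdorff1 A"
    using meas A by (simp add: emeasure_distr emeasure_hausdorff1 vimage)
qed simp

lemma
  fixes R R' :: "'a::metric_space \<Rightarrow> 'a" and g :: "'a \<Rightarrow> real"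
  assumes "\<And>x y. dist (R x) (R y) = dist x y" "\<And>x. R (R' x) = x" "integrable hausdorff1 g"
  shows integrable_hausdorff1_isometry: "integrable hausdorff1 (\<lambda>x. g (R x))"
    and integral_hausdorff1_isometry: "(LINT x|hausdorff1. g (R x)) = (LINT x|hausdorff1. g x)"
proof -
  have "continuous_on UNIV R"
    using assms(1) by (metis continuous_on_iff)
  then have meas: "R \<in> hausdorff1 \<rightarrow>\<^sub>M borel"
    by (simp add: borel_measurable_continuous_onI measurable_cong_sets[OF sets_hausdorff1 refl])
  have g: "g \<in> borel_measurable borel"
    using borel_measurable_integrable[OF assms(3)]
    by (simp add: measurable_cong_sets[OF sets_hausdorff1 refl])
  note d = distr_hausdorff1_isometry[of R R', OF assms(1,2)]
  show "integrable hausdorff1 (\<lambda>x. g (R x))"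
    using integrable_distr[OF meas, of g] assms(3) d by simp
  show "(LINT x|hausdorff1. g (R x)) = (LINT x|hausdorff1. g x)"
    using integral_distr[OF meas g] d by simp
qed

text \<open>
  If \<open>f\<close> is integrable on \<open>A\<close>, the three terms of the functional equation have the same integral
  over \<open>A\<close>, so this integral is multiplied by \<^term>\<open>cos a\<close> without changing. Otherwise
  the Bochner integral has the default value \<open>0\<close>.
\<close>
lemma integral_rotation_invariant_eq_0:
  fixes f :: "real ^ 2 \<Rightarrow> real"
  assumes inv: "\<And>x. rotation a x \<in> A \<longleftrightarrow> x \<in> A" and "cos a \<noteq> 1"
    and f: "\<And>x. f (rotation a x) + f (rotation (- a) x) = 2 * cos a * f x"
  shows "(LINT x:A|hausdorff1. f x) = 0"
proof -
  define G where "G x = indicator A x * f x" for x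
  have I: "(LINT x:A|hausdorff1. f x) = (LINT x|hausdorff1. G x)"
    by (simp add: set_lebesgue_integral_def G_def)
  show ?thesis
  proof (cases "integrable hausdorff1 G")
    case False
    then show ?thesis unfolding I by (rule not_integrable_integral_eq)
  next
    case True
    have dist: "dist (rotation b x) (rotation b y) = dist x y" for b x y
      using orthogonal_transformation_rotation by (simp add: orthogonal_transformation_isometry)
    have canc: "rotation b (rotation (- b) x) = x" for b x
      using rotation_minus_cancel[of "- b"] by simp
    note int = integrable_hausdorff1_isometry[OF dist canc True]
      integral_hausdorff1_isometry[OF dist canc True]
    have inv': "rotation (- a) x \<in> A \<longleftrightarrow> x \<in> A" for x
      using inv[of "rotation (- a) x"] canc[of a x] by simp
    have "G (rotation a x) + G (rotation (- a) x) = 2 * cos a * G x" for x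
      using f[of x] by (auto simp: G_def inv inv' indicator_def)
    then have "(LINT x|hausdorff1. G (rotation a x) + G (rotation (- a) x)) =
        2 * cos a * (LINT x|hausdorff1. G x)"
      by simp
    then have "2 * (LINT x|hausdorff1. G x) = 2 * cos a * (LINT x|hausdorff1. G x)"
      using int by simp
    then show ?thesis unfolding I using \<open>cos a \<noteq> 1\<close> by simp
  qed
qed

lemma odd_bump_rotation:
  "odd_bump (rotation a x) + odd_bump (rotation (- a) x) = 2 * cos a * odd_bump x"
proof -
  have "rotation b x \<bullet> rotation b x = x \<bullet> x" for b
    using orthogonal_transformation_rotation by (auto simp: orthogonal_transformation_def)
  then show ?thesis by (simp add: odd_bump_def algebra_simps)
qed

section \<open>Broken rays are repeated under a rotation\<close>

text \<open>
  Continuous induction along an interval: agreement up to \<open>t\<close> passes to limits by continuity, and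
  \<open>step\<close> extends it a little beyond \<open>t\<close>. Only the local description of a broken ray is given, so this
  is how global statements about it are obtained.
\<close>
lemma agree_on_interval:
  fixes g h :: "real \<Rightarrow> 'a::t2_space"
  assumes cont: "continuous_on UNIV g" "continuous_on UNIV h"
    and start: "g a = h a"
    and step: "\<And>t. a \<le> t \<Longrightarrow> t < b \<Longrightarrow> \<forall>s\<in>{a..t}. g s = h s \<Longrightarrow> \<exists>e>0. \<forall>s\<in>{t..t + e}. g s = h s"
    and x: "x \<in> {a..b}"
  shows "g x = h x"
proof (rule ccontr)
  assume ne: "g x \<noteq> h x"
  define N where "N = {s \<in> {a..b}. g s \<noteq> h s}"
  define m where "m = Inf N"
  have bdd: "bdd_below N" by (rule bdd_belowI[of _ a]) (auto simp: N_def)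
  have xN: "x \<in> N" using ne x by (simp add: N_def)
  have m: "a \<le> m" "m \<le> x"
    unfolding m_def using xN bdd by (auto intro!: cInf_greatest cInf_lower simp: N_def)
  have before: "g s = h s" if "a \<le> s" "s < m" for s
  proof (rule ccontr)
    assume "g s \<noteq> h s"
    then have "s \<in> N" using that m x by (auto simp: N_def)
    then show False using that(2) cInf_lower[OF _ bdd, of s] by (simp add: m_def)
  qed
  have at: "g m = h m"
  proof (cases "a < m")
    case True
    have lim: "(g \<longlongrightarrow> g m) (at_left m)" "(h \<longlongrightarrow> h m) (at_left m)"
      using cont by (auto simp: continuous_on_eq_continuous_at continuous_at_imp_continuous_at_within
          simp flip: continuous_within)
    have "eventually (\<lambda>s. g s = h s) (at_left m)"
      using eventually_at_left_real[OF True] by eventually_elim (auto intro: before)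
    then have "(h \<longlongrightarrow> g m) (at_left m)"
      by (rule Lim_transform_eventually[OF lim(1)])
    with lim(2) show ?thesis
      using tendsto_unique[OF trivial_limit_at_left_real] by metis
  qed (use m start in auto)
  with ne have "m \<noteq> x" by auto
  with m x have "m < b" by auto
  have upto: "\<forall>s\<in>{a..m}. g s = h s"
    using before at by force
  obtain e where e: "e > 0" "\<forall>s\<in>{m..m + e}. g s = h s"
    using step[OF m(1) \<open>m < b\<close> upto] by blast
  have "m + e \<le> Inf N"
  proof (rule cInf_greatest)
    fix s assume "s \<in> N"
    then show "m + e \<le> s" using upto e(2) by (force simp: N_def not_le)
  qed (use xN in auto)
  with e(1) show False by (simp add: m_def)
qed

lemma broken_ray_local:
  assumes "broken_ray \<gamma>"
  shows "\<exists>u w. \<exists>\<epsilon>>0. norm u = 1 \<and> norm w = 1 \<and>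
    (\<forall>s\<in>{t - \<epsilon>..t}. \<gamma> s = \<gamma> t + (s - t) *\<^sub>R u) \<and>
    (\<forall>s\<in>{t..t + \<epsilon>}. \<gamma> s = \<gamma> t + (s - t) *\<^sub>R w) \<and>
    (norm (\<gamma> t) < 1 \<longrightarrow> w = u) \<and> (norm (\<gamma> t) = 1 \<longrightarrow> w = reflect (\<gamma> t) u)"
  using spec[OF conjunct2[OF assms[unfolded broken_ray_def mem_ball_0 mem_sphere_0]], of t] .

lemma broken_ray_norm_le: "broken_ray \<gamma> \<Longrightarrow> norm (\<gamma> t) \<le> 1"
  unfolding broken_ray_def by (metis mem_cball_0 rangeI subsetD)

lemma broken_ray_continuous:
  assumes "broken_ray \<gamma>"
  shows "continuous_on UNIV \<gamma>"
  unfolding continuous_on_iff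
proof (intro ballI allI impI)
  fix t d :: real assume "d > 0"
  obtain u w \<epsilon> where B: "\<epsilon> > 0" "norm u = 1" "norm w = 1"
    "\<forall>s\<in>{t - \<epsilon>..t}. \<gamma> s = \<gamma> t + (s - t) *\<^sub>R u"
    "\<forall>s\<in>{t..t + \<epsilon>}. \<gamma> s = \<gamma> t + (s - t) *\<^sub>R w"
    using broken_ray_local[OF assms, of t] by (elim exE conjE) (rule that)
  have "dist (\<gamma> s) (\<gamma> t) < d" if "dist s t < min d \<epsilon>" for s
  proof -
    have "dist (\<gamma> s) (\<gamma> t) = dist s t"
    proof (cases "s \<le> t")
      case True
      then show ?thesis using bspec[OF B(4), of s] B(2) that by (auto simp: dist_norm)
    next
      case False
      then show ?thesis using bspec[OF B(5), of s] B(3) that by (auto simp: dist_norm)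
    qed
    then show ?thesis using that by simp
  qed
  then show "\<exists>e>0. \<forall>s\<in>UNIV. dist s t < e \<longrightarrow> dist (\<gamma> s) (\<gamma> t) < d"
    using \<open>d > 0\<close> \<open>\<epsilon> > 0\<close> by (intro exI[of _ "min d \<epsilon>"]) auto
qed

lemma incoming_velocity_unique:
  fixes \<gamma> :: "real \<Rightarrow> 'a::real_vector"
  assumes "\<epsilon> > 0" "\<forall>s\<in>{t - \<epsilon>..t}. \<gamma> s = \<gamma> t + (s - t) *\<^sub>R u"
    and "\<delta> > 0" "\<forall>s\<in>{t - \<delta>..t}. \<gamma> s = \<gamma> t + (s - t) *\<^sub>R v"
  shows "u = v"
proof -
  define m where "m = min \<epsilon> \<delta>"
  have "m > 0" using assms(1,3) by (simp add: m_def)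
  moreover have "(- m) *\<^sub>R u = (- m) *\<^sub>R v"
    using bspec[OF assms(2), of "t - m"] bspec[OF assms(4), of "t - m"] \<open>m > 0\<close> by (simp add: m_def)
  ultimately show ?thesis by simp
qed

text \<open>
  Agreement on an interval before a time \<open>r\<close> forces equal incoming velocities at \<open>r\<close>. The outgoing
  velocity is a function of the position and the incoming velocity, so the agreement continues.
\<close>
lemma broken_ray_deterministic:
  assumes \<gamma>: "broken_ray \<gamma>" and \<eta>: "broken_ray \<eta>"
    and "e > 0" and start: "\<forall>s\<in>{a..a + e}. \<gamma> s = \<eta> s"
    and "a \<le> t"
  shows "\<gamma> t = \<eta> t"
proof (rule agree_on_interval[of \<gamma> \<eta> a t])
  fix r assume r: "a \<le> r" "r < t" "\<forall>s\<in>{a..r}. \<gamma> s = \<eta> s"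
  show "\<exists>e>0. \<forall>s\<in>{r..r + e}. \<gamma> s = \<eta> s"
  proof (cases "r = a")
    case True
    then show ?thesis using \<open>e > 0\<close> start by blast
  next
    case False
    obtain u w \<epsilon> where B: "\<epsilon> > 0" "norm u = 1" "norm w = 1"
      "\<forall>s\<in>{r - \<epsilon>..r}. \<gamma> s = \<gamma> r + (s - r) *\<^sub>R u"
      "\<forall>s\<in>{r..r + \<epsilon>}. \<gamma> s = \<gamma> r + (s - r) *\<^sub>R w"
      "norm (\<gamma> r) < 1 \<longrightarrow> w = u" "norm (\<gamma> r) = 1 \<longrightarrow> w = reflect (\<gamma> r) u"
      using broken_ray_local[OF \<gamma>, of r] by (elim exE conjE) (rule that)
    obtain u' w' \<epsilon>' where B': "\<epsilon>' > 0" "norm u' = 1" "norm w' = 1"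
      "\<forall>s\<in>{r - \<epsilon>'..r}. \<eta> s = \<eta> r + (s - r) *\<^sub>R u'"
      "\<forall>s\<in>{r..r + \<epsilon>'}. \<eta> s = \<eta> r + (s - r) *\<^sub>R w'"
      "norm (\<eta> r) < 1 \<longrightarrow> w' = u'" "norm (\<eta> r) = 1 \<longrightarrow> w' = reflect (\<eta> r) u'"
      using broken_ray_local[OF \<eta>, of r] by (elim exE conjE) (rule that)
    have eq: "\<gamma> r = \<eta> r" using r(1,3) by auto
    have "u = u'"
    proof (rule incoming_velocity_unique[of \<epsilon> r \<gamma> u "min \<epsilon>' (r - a)" u'])
      show "\<forall>s\<in>{r - min \<epsilon>' (r - a)..r}. \<gamma> s = \<gamma> r + (s - r) *\<^sub>R u'"
      proof
        fix s assume s: "s \<in> {r - min \<epsilon>' (r - a)..r}"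
        then have "\<gamma> s = \<eta> s" using r(3) by auto
        also have "\<eta> s = \<eta> r + (s - r) *\<^sub>R u'" using s by (intro bspec[OF B'(4)]) auto
        finally show "\<gamma> s = \<gamma> r + (s - r) *\<^sub>R u'" unfolding eq .
      qed
    qed (use B(1,4) B'(1) False r(1) in \<open>simp_all only: min_less_iff_conj diff_gt_0_iff_gt\<close>, simp)
    moreover have "norm (\<gamma> r) < 1 \<or> norm (\<gamma> r) = 1"
      using broken_ray_norm_le[OF \<gamma>, of r] by linarith
    ultimately have "w = w'" using B(6,7) B'(6,7) eq by auto
    have "\<forall>s\<in>{r..r + min \<epsilon> \<epsilon>'}. \<gamma> s = \<eta> s"
    proof
      fix s assume s: "s \<in> {r..r + min \<epsilon> \<epsilon>'}"
      have "\<gamma> s = \<gamma> r + (s - r) *\<^sub>R w" using s by (intro bspec[OF B(5)]) auto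
      also have "\<dots> = \<eta> r + (s - r) *\<^sub>R w'" unfolding eq \<open>w = w'\<close> ..
      also have "\<dots> = \<eta> s" using s by (intro bspec[OF B'(5), symmetric]) auto
      finally show "\<gamma> s = \<eta> s" .
    qed
    then show ?thesis using B(1) B'(1) by (intro exI[of _ "min \<epsilon> \<epsilon>'"]) auto
  qed
qed (use assms(3,5) bspec[OF start, of a] in \<open>auto intro: broken_ray_continuous \<gamma> \<eta>\<close>)

text \<open>
  Velocities can only change on the boundary, so a ray that has started in the direction \<open>w\<close> follows
  this line as long as the line stays in the open disk.
\<close>
lemma broken_ray_straight:
  assumes \<gamma>: "broken_ray \<gamma>"
    and "e > 0" and start: "\<forall>s\<in>{a..a + e}. \<gamma> s = \<gamma> a + (s - a) *\<^sub>R w"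
    and inside: "\<And>r. 0 < r \<Longrightarrow> r < l \<Longrightarrow> norm (\<gamma> a + r *\<^sub>R w) < 1"
    and t: "t \<in> {a..a + l}"
  shows "\<gamma> t = \<gamma> a + (t - a) *\<^sub>R w"
proof (rule agree_on_interval[of \<gamma> "\<lambda>t. \<gamma> a + (t - a) *\<^sub>R w" a "a + l"])
  fix r assume r: "a \<le> r" "r < a + l" "\<forall>s\<in>{a..r}. \<gamma> s = \<gamma> a + (s - a) *\<^sub>R w"
  show "\<exists>e>0. \<forall>s\<in>{r..r + e}. \<gamma> s = \<gamma> a + (s - a) *\<^sub>R w"
  proof (cases "r = a")
    case True
    then show ?thesis using \<open>e > 0\<close> start by blast
  next
    case False
    obtain u w' \<epsilon> where B: "\<epsilon> > 0" "norm u = 1" "norm w' = 1"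
      "\<forall>s\<in>{r - \<epsilon>..r}. \<gamma> s = \<gamma> r + (s - r) *\<^sub>R u"
      "\<forall>s\<in>{r..r + \<epsilon>}. \<gamma> s = \<gamma> r + (s - r) *\<^sub>R w'"
      "norm (\<gamma> r) < 1 \<longrightarrow> w' = u"
      using broken_ray_local[OF \<gamma>, of r] by (elim exE conjE) (rule that)
    have r_eq: "\<gamma> r = \<gamma> a + (r - a) *\<^sub>R w" using r(1) by (intro bspec[OF r(3)]) auto
    have line: "\<gamma> a + (s - a) *\<^sub>R w = \<gamma> r + (s - r) *\<^sub>R w" for s
      unfolding r_eq by (simp add: algebra_simps)
    have "u = w"
    proof (rule incoming_velocity_unique[OF B(1,4)])
      show "r - a > 0" using False r(1) by simp
      have "r - (r - a) = a" by simp
      then show "\<forall>s\<in>{r - (r - a)..r}. \<gamma> s = \<gamma> r + (s - r) *\<^sub>R w"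
        using r(3) unfolding line by (simp only:)
    qed
    moreover have "norm (\<gamma> r) < 1"
      unfolding r_eq using False r(1,2) by (intro inside) auto
    ultimately have "w' = w" using B(6) by simp
    then have "\<forall>s\<in>{r..r + \<epsilon>}. \<gamma> s = \<gamma> a + (s - a) *\<^sub>R w"
      using B(5) unfolding line by (simp only:)
    then show ?thesis using B(1) by blast
  qed
next
  show "continuous_on UNIV \<gamma>"
    using \<gamma> by (rule broken_ray_continuous)
  show "continuous_on UNIV (\<lambda>t. \<gamma> a + (t - a) *\<^sub>R w)"
    by (intro continuous_intros)
qed (use t in simp_all)

text \<open>Otherwise the ray would run along a straight line for ever, but every line leaves the disk.\<close>
lemma broken_ray_reaches_boundary:
  assumes "broken_ray \<gamma>"
  obtains t where "norm (\<gamma> t) = 1"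
proof (cases "norm (\<gamma> 0) = 1")
  case False
  then have lt: "norm (\<gamma> 0) < 1" using broken_ray_norm_le[OF assms, of 0] by linarith
  obtain u w \<epsilon> where B: "\<epsilon> > 0" "norm u = 1" "norm w = 1"
    "\<forall>s\<in>{0 - \<epsilon>..0}. \<gamma> s = \<gamma> 0 + (s - 0) *\<^sub>R u"
    "\<forall>s\<in>{0..0 + \<epsilon>}. \<gamma> s = \<gamma> 0 + (s - 0) *\<^sub>R w"
    using broken_ray_local[OF assms, of 0] by (elim exE conjE) (rule that)
  define x where "x = \<gamma> 0"
  (* l is the positive root of norm (x + l w) = 1, and h a quarter of the discriminant. *)
  define h where "h = (x \<bullet> w)\<^sup>2 + 1 - x \<bullet> x"
  define l where "l = sqrt h - x \<bullet> w"
  have xx: "x \<bullet> x < 1"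
    using lt by (simp add: x_def dot_square_norm abs_square_less_1)
  have ww: "w \<bullet> w = 1" using B(3) by (simp add: dot_square_norm)
  have "\<bar>x \<bullet> w\<bar> < sqrt h"
    using xx by (intro real_less_rsqrt) (simp add: h_def)
  then have l: "l > 0" "l + 2 * (x \<bullet> w) > 0" by (auto simp: l_def)
  have hsq: "(sqrt h)\<^sup>2 = h"
    using xx zero_le_power2[of "x \<bullet> w"] unfolding h_def by (intro real_sqrt_pow2) linarith
  then have l2: "l * l + 2 * l * (x \<bullet> w) + x \<bullet> x = 1"
    by (simp add: l_def h_def power2_eq_square algebra_simps)
  have nrm: "(norm (x + r *\<^sub>R w))\<^sup>2 = r * r + 2 * r * (x \<bullet> w) + x \<bullet> x" for r
    unfolding power2_norm_eq_inner
    by (simp add: inner_add ww inner_commute algebra_simps)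
  have "norm (x + r *\<^sub>R w) < 1" if "0 < r" "r < l" for r
  proof -
    have "0 < (l - r) * (l + r + 2 * (x \<bullet> w))"
      using that l by (intro mult_pos_pos) auto
    then have "(norm (x + r *\<^sub>R w))\<^sup>2 < 1\<^sup>2"
      using l2 by (simp add: nrm algebra_simps)
    then show ?thesis by (rule power2_less_imp_less) simp
  qed
  then have "\<gamma> l = x + (l - 0) *\<^sub>R w"
    unfolding x_def by (intro broken_ray_straight[OF assms B(1,5)]) (use l in auto)
  then have "(norm (\<gamma> l))\<^sup>2 = 1\<^sup>2"
    using l2 by (simp add: nrm)
  then have "norm (\<gamma> l) = 1"
    by (rule power2_eq_imp_eq) simp_all
  then show ?thesis by (rule that)
qed (rule that)

lemma broken_ray_shift:
  assumes "broken_ray \<gamma>"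
  shows "broken_ray (\<lambda>t. \<gamma> (t + l))"
  unfolding broken_ray_def
proof (intro conjI allI)
  show "range (\<lambda>t. \<gamma> (t + l)) \<subseteq> cball 0 1"
    using broken_ray_norm_le[OF assms] by auto
  fix t
  obtain u w \<epsilon> where B: "\<epsilon> > 0" "norm u = 1" "norm w = 1"
    "\<forall>s\<in>{t + l - \<epsilon>..t + l}. \<gamma> s = \<gamma> (t + l) + (s - (t + l)) *\<^sub>R u"
    "\<forall>s\<in>{t + l..t + l + \<epsilon>}. \<gamma> s = \<gamma> (t + l) + (s - (t + l)) *\<^sub>R w"
    "norm (\<gamma> (t + l)) < 1 \<longrightarrow> w = u" "norm (\<gamma> (t + l)) = 1 \<longrightarrow> w = reflect (\<gamma> (t + l)) u"
    using broken_ray_local[OF assms, of "t + l"] by (elim exE conjE) (rule that)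
  show "\<exists>u w. \<exists>\<epsilon>>0. norm u = 1 \<and> norm w = 1 \<and>
        (\<forall>s\<in>{t - \<epsilon>..t}. \<gamma> (s + l) = \<gamma> (t + l) + (s - t) *\<^sub>R u) \<and>
        (\<forall>s\<in>{t..t + \<epsilon>}. \<gamma> (s + l) = \<gamma> (t + l) + (s - t) *\<^sub>R w) \<and>
        (\<gamma> (t + l) \<in> ball 0 1 \<longrightarrow> w = u) \<and>
        (\<gamma> (t + l) \<in> sphere 0 1 \<longrightarrow> w = reflect (\<gamma> (t + l)) u)"
  proof (rule exI[of _ u], rule exI[of _ w], rule exI[of _ \<epsilon>], intro conjI ballI)
    fix s assume "s \<in> {t - \<epsilon>..t}"
    then have "s + l \<in> {t + l - \<epsilon>..t + l}" by simp
    from bspec[OF B(4) this] show "\<gamma> (s + l) = \<gamma> (t + l) + (s - t) *\<^sub>R u" by simp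
  next
    fix s assume "s \<in> {t..t + \<epsilon>}"
    then have "s + l \<in> {t + l..t + l + \<epsilon>}" by simp
    from bspec[OF B(5) this] show "\<gamma> (s + l) = \<gamma> (t + l) + (s - t) *\<^sub>R w" by simp
  qed (use B(1-3,6,7) in simp_all)
qed

lemma reflect_orthogonal_transformation:
  assumes "orthogonal_transformation R"
  shows "R (reflect n u) = reflect (R n) (R u)"
  using assms
  by (simp add: reflect_def orthogonal_transformation_def linear_diff linear_cmul)

lemma broken_ray_orthogonal_transformation:
  assumes "broken_ray \<gamma>" and R: "orthogonal_transformation R"
  shows "broken_ray (\<lambda>t. R (\<gamma> t))"
  unfolding broken_ray_def
proof (intro conjI allI)
  have norm_R: "norm (R x) = norm x" for x
    using R by (rule orthogonal_transformation_norm)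
  have lin: "R (x + c *\<^sub>R y) = R x + c *\<^sub>R R y" for x y c
    using R by (simp add: orthogonal_transformation_def linear_add linear_cmul)
  show "range (\<lambda>t. R (\<gamma> t)) \<subseteq> cball 0 1"
    using broken_ray_norm_le[OF assms(1)] by (auto simp: norm_R)
  fix t
  obtain u w \<epsilon> where B: "\<epsilon> > 0" "norm u = 1" "norm w = 1"
    "\<forall>s\<in>{t - \<epsilon>..t}. \<gamma> s = \<gamma> t + (s - t) *\<^sub>R u"
    "\<forall>s\<in>{t..t + \<epsilon>}. \<gamma> s = \<gamma> t + (s - t) *\<^sub>R w"
    "norm (\<gamma> t) < 1 \<longrightarrow> w = u" "norm (\<gamma> t) = 1 \<longrightarrow> w = reflect (\<gamma> t) u"
    using broken_ray_local[OF assms(1), of t] by (elim exE conjE) (rule that)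
  show "\<exists>u w. \<exists>\<epsilon>>0. norm u = 1 \<and> norm w = 1 \<and>
        (\<forall>s\<in>{t - \<epsilon>..t}. R (\<gamma> s) = R (\<gamma> t) + (s - t) *\<^sub>R u) \<and>
        (\<forall>s\<in>{t..t + \<epsilon>}. R (\<gamma> s) = R (\<gamma> t) + (s - t) *\<^sub>R w) \<and>
        (R (\<gamma> t) \<in> ball 0 1 \<longrightarrow> w = u) \<and>
        (R (\<gamma> t) \<in> sphere 0 1 \<longrightarrow> w = reflect (R (\<gamma> t)) u)"
  proof (rule exI[of _ "R u"], rule exI[of _ "R w"], rule exI[of _ \<epsilon>], intro conjI ballI)
    fix s assume "s \<in> {t - \<epsilon>..t}"
    from arg_cong[OF bspec[OF B(4) this], of R]
    show "R (\<gamma> s) = R (\<gamma> t) + (s - t) *\<^sub>R R u" unfolding lin .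
  next
    fix s assume "s \<in> {t..t + \<epsilon>}"
    from arg_cong[OF bspec[OF B(5) this], of R]
    show "R (\<gamma> s) = R (\<gamma> t) + (s - t) *\<^sub>R R w" unfolding lin .
  next
    show "R (\<gamma> t) \<in> sphere 0 1 \<longrightarrow> R w = reflect (R (\<gamma> t)) (R u)"
      using B(7) by (simp add: norm_R flip: reflect_orthogonal_transformation[OF R])
  qed (use B(1-3,6) in \<open>simp_all add: norm_R\<close>)
qed

text \<open>
  If \<open>b\<close> is a boundary point and \<open>w\<close> an outgoing velocity there, then \<open>b + 2 k w\<close> is the other end of
  the chord. The rotation by the angle that the chord subtends at the centre maps one end to the other,
  and by the reflection law it takes the outgoing velocity at the first end to that at the second.
\<close>
lemma rotation_of_chord:
  fixes b w :: "real ^ 2"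
  assumes "norm b = 1" "norm w = 1" "b \<bullet> w = - k" "k \<noteq> 0"
  obtains a where "cos a \<noteq> 1" "rotation a b = b + (2 * k) *\<^sub>R w"
    "rotation a w = reflect (b + (2 * k) *\<^sub>R w) w"
proof -
  (* Minus k and x are the cosine and the sine of the angle from b to w, so the chord subtends the
     angle whose cosine and sine are 1 - 2 k^2 and 2 k x. *)
  define x where "x = b $ 1 * w $ 2 - b $ 2 * w $ 1"
  have comp: "b $ 1 * b $ 1 + b $ 2 * b $ 2 = 1" "w $ 1 * w $ 1 + w $ 2 * w $ 2 = 1"
    "b $ 1 * w $ 1 + b $ 2 * w $ 2 = - k"
    using assms(1-3) by (simp_all add: norm_eq_1 inner_vec_def sum_2)
  then have "k * k + x * x = 1"
    unfolding x_def by algebra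
  then have "(1 - 2 * k * k)\<^sup>2 + (2 * k * x)\<^sup>2 = 1"
    by algebra
  then obtain a where a: "cos a = 1 - 2 * k * k" "sin a = 2 * k * x"
    by (metis sincos_total_2pi)
  show ?thesis
  proof (rule that[of a])
    show "cos a \<noteq> 1" using a \<open>k \<noteq> 0\<close> by simp
    have inner: "w \<bullet> (b + (2 * k) *\<^sub>R w) = k"
      using assms(2,3) by (simp add: inner_add inner_commute norm_eq_1)
    have "(1 - 2 * k * k) * b $ 1 - 2 * k * x * b $ 2 = b $ 1 + 2 * k * w $ 1"
      "2 * k * x * b $ 1 + (1 - 2 * k * k) * b $ 2 = b $ 2 + 2 * k * w $ 2"
      using comp unfolding x_def by algebra+
    then show "rotation a b = b + (2 * k) *\<^sub>R w"
      unfolding vec_eq_iff forall_2 rotation_nth a by simp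
    have "(1 - 2 * k * k) * w $ 1 - 2 * k * x * w $ 2 = w $ 1 - 2 * k * (b $ 1 + 2 * k * w $ 1)"
      "2 * k * x * w $ 1 + (1 - 2 * k * k) * w $ 2 = w $ 2 - 2 * k * (b $ 2 + 2 * k * w $ 2)"
      using comp unfolding x_def by algebra+
    then show "rotation a w = reflect (b + (2 * k) *\<^sub>R w) w"
      unfolding vec_eq_iff forall_2 rotation_nth a reflect_def inner by simp
  qed
qed

text \<open>
  Here \<open>t\<^sub>0\<close> is a time of reflection and \<open>l\<close> the length of a chord. Both sides are broken rays, and
  they have the same position and outgoing velocity at \<open>t\<^sub>0\<close>.
\<close>
lemma broken_ray_eventually_rotation:
  assumes \<gamma>: "broken_ray \<gamma>"
  shows "\<exists>a l t\<^sub>0. cos a \<noteq> 1 \<and> (\<forall>t\<ge>t\<^sub>0. \<gamma> (t + l) = rotation a (\<gamma> t))"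
proof -
  obtain t\<^sub>0 where t0: "norm (\<gamma> t\<^sub>0) = 1"
    using broken_ray_reaches_boundary[OF \<gamma>] by blast
  define b where "b = \<gamma> t\<^sub>0"
  obtain u w \<epsilon> where B: "\<epsilon> > 0" "norm u = 1" "norm w = 1"
    "\<forall>s\<in>{t\<^sub>0 - \<epsilon>..t\<^sub>0}. \<gamma> s = b + (s - t\<^sub>0) *\<^sub>R u"
    "\<forall>s\<in>{t\<^sub>0..t\<^sub>0 + \<epsilon>}. \<gamma> s = b + (s - t\<^sub>0) *\<^sub>R w"
    "norm b = 1 \<longrightarrow> w = reflect b u"
    using broken_ray_local[OF \<gamma>, of t\<^sub>0] unfolding b_def[symmetric] by (elim exE conjE) (rule that)
  have w: "w = reflect b u" using t0 B(6) by (simp add: b_def)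
  have bb: "b \<bullet> b = 1" and uu: "u \<bullet> u = 1" and ww: "w \<bullet> w = 1"
    using t0 B(2,3) by (simp_all add: b_def norm_eq_1)
  define k where "k = b \<bullet> u"
  have "k > 0"
  proof -
    (* The ray was in the disk shortly before t0, so it moved outwards when it hit the circle. *)
    have "(norm (b - \<epsilon> *\<^sub>R u))\<^sup>2 \<le> 1"
      using broken_ray_norm_le[OF \<gamma>, of "t\<^sub>0 - \<epsilon>"] bspec[OF B(4), of "t\<^sub>0 - \<epsilon>"] B(1)
      by (simp add: power_le_one)
    then have "\<epsilon> * \<epsilon> \<le> \<epsilon> * (2 * k)"
      unfolding power2_norm_eq_inner
      by (simp add: inner_diff bb uu inner_commute k_def algebra_simps)
    then show ?thesis using B(1) by simp
  qed
  have bw: "b \<bullet> w = - k"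
    by (simp add: w reflect_def inner_diff bb k_def inner_commute)
  have nrm: "(norm (b + r *\<^sub>R w))\<^sup>2 = 1 - r * (2 * k - r)" for r
    unfolding power2_norm_eq_inner
    by (simp add: inner_add bb ww bw inner_commute algebra_simps)
  define c where "c = b + (2 * k) *\<^sub>R w"
  have chord: "\<gamma> t = b + (t - t\<^sub>0) *\<^sub>R w" if "t \<in> {t\<^sub>0..t\<^sub>0 + 2 * k}" for t
    unfolding b_def
  proof (rule broken_ray_straight[OF \<gamma> B(1) _ _ that])
    fix r assume "0 < r" "r < 2 * k"
    then have "(norm (b + r *\<^sub>R w))\<^sup>2 < 1\<^sup>2" by (simp add: nrm)
    then have "norm (b + r *\<^sub>R w) < 1" by (rule power2_less_imp_less) simp
    then show "norm (\<gamma> t\<^sub>0 + r *\<^sub>R w) < 1" by (simp add: b_def)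
  next
    show "\<forall>s\<in>{t\<^sub>0..t\<^sub>0 + \<epsilon>}. \<gamma> s = \<gamma> t\<^sub>0 + (s - t\<^sub>0) *\<^sub>R w"
      using B(5) unfolding b_def .
  qed
  have c: "\<gamma> (t\<^sub>0 + 2 * k) = c"
    using chord[of "t\<^sub>0 + 2 * k"] \<open>k > 0\<close> by (simp add: c_def)
  have "(norm c)\<^sup>2 = 1\<^sup>2"
    unfolding c_def nrm by simp
  then have "norm c = 1"
    by (rule power2_eq_imp_eq) simp_all
  obtain u' w' \<delta> where C: "\<delta> > 0" "norm u' = 1" "norm w' = 1"
    "\<forall>s\<in>{t\<^sub>0 + 2 * k - \<delta>..t\<^sub>0 + 2 * k}. \<gamma> s = \<gamma> (t\<^sub>0 + 2 * k) + (s - (t\<^sub>0 + 2 * k)) *\<^sub>R u'"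
    "\<forall>s\<in>{t\<^sub>0 + 2 * k..t\<^sub>0 + 2 * k + \<delta>}. \<gamma> s = \<gamma> (t\<^sub>0 + 2 * k) + (s - (t\<^sub>0 + 2 * k)) *\<^sub>R w'"
    "norm (\<gamma> (t\<^sub>0 + 2 * k)) = 1 \<longrightarrow> w' = reflect (\<gamma> (t\<^sub>0 + 2 * k)) u'"
    using broken_ray_local[OF \<gamma>, of "t\<^sub>0 + 2 * k"] by (elim exE conjE) (rule that)
  have "u' = w"
  proof (rule incoming_velocity_unique[OF C(1,4)])
    show "2 * k > 0" using \<open>k > 0\<close> by simp
    show "\<forall>s\<in>{t\<^sub>0 + 2 * k - 2 * k..t\<^sub>0 + 2 * k}.
        \<gamma> s = \<gamma> (t\<^sub>0 + 2 * k) + (s - (t\<^sub>0 + 2 * k)) *\<^sub>R w"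
      unfolding c using chord by (simp add: c_def algebra_simps)
  qed
  then have w': "w' = reflect c w" using C(6) \<open>norm c = 1\<close> by (simp add: c)
  have "norm b = 1" "k \<noteq> 0"
    using t0 \<open>k > 0\<close> by (simp_all add: b_def)
  then obtain a where a: "cos a \<noteq> 1" "rotation a b = c" "rotation a w = w'"
    using rotation_of_chord[OF _ B(3) bw, folded c_def w'] by blast
  have "\<gamma> (t + 2 * k) = rotation a (\<gamma> t)" if "t\<^sub>0 \<le> t" for t
  proof (rule broken_ray_deterministic[of "\<lambda>t. \<gamma> (t + 2 * k)" "\<lambda>t. rotation a (\<gamma> t)"])
    show "broken_ray (\<lambda>t. \<gamma> (t + 2 * k))"
      using \<gamma> by (rule broken_ray_shift)
    show "broken_ray (\<lambda>t. rotation a (\<gamma> t))"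
      using \<gamma> orthogonal_transformation_rotation by (rule broken_ray_orthogonal_transformation)
    show "min \<epsilon> \<delta> > 0" using B(1) C(1) by simp
    show "\<forall>s\<in>{t\<^sub>0..t\<^sub>0 + min \<epsilon> \<delta>}. \<gamma> (s + 2 * k) = rotation a (\<gamma> s)"
    proof
      fix s assume s: "s \<in> {t\<^sub>0..t\<^sub>0 + min \<epsilon> \<delta>}"
      then have "\<gamma> s = b + (s - t\<^sub>0) *\<^sub>R w"
        by (intro bspec[OF B(5)]) auto
      moreover have "linear (rotation a)"
        using orthogonal_transformation_rotation by (rule orthogonal_transformation_linear)
      ultimately have "rotation a (\<gamma> s) = c + (s - t\<^sub>0) *\<^sub>R w'"
        by (simp add: linear_add linear_cmul a)
      moreover have "\<gamma> (s + 2 * k) = c + (s + 2 * k - (t\<^sub>0 + 2 * k)) *\<^sub>R w'"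
        unfolding c[symmetric] using s by (intro bspec[OF C(5)]) auto
      ultimately show "\<gamma> (s + 2 * k) = rotation a (\<gamma> s)" by simp
    qed
  qed (rule that)
  with a(1) show ?thesis by blast
qed

text \<open>Periodicity carries the relation between \<open>\<gamma> (t + l)\<close> and \<open>\<gamma> t\<close> back from late times to all times.\<close>
lemma periodic_broken_ray_range_rotation:
  assumes "\<gamma> \<in> periodic_broken_rays"
  obtains a where "cos a \<noteq> 1" "\<And>x. rotation a x \<in> range \<gamma> \<longleftrightarrow> x \<in> range \<gamma>"
proof -
  obtain T where \<gamma>: "broken_ray \<gamma>" and T: "T > 0" "\<And>t. \<gamma> (t + T) = \<gamma> t"
    using assms by (auto simp: periodic_broken_rays_def)
  have period: "\<gamma> (t + real n * T) = \<gamma> t" for t n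
  proof (induction n)
    case (Suc n)
    then show ?case using T(2)[of "t + real n * T"] by (simp add: algebra_simps)
  qed simp
  obtain t\<^sub>0 l a where a: "cos a \<noteq> 1" "\<And>t. t\<^sub>0 \<le> t \<Longrightarrow> \<gamma> (t + l) = rotation a (\<gamma> t)"
    using broken_ray_eventually_rotation[OF \<gamma>] by blast
  have rot: "\<gamma> (t + l) = rotation a (\<gamma> t)" for t
  proof -
    obtain n where "t\<^sub>0 - t < real n * T"
      using reals_Archimedean3[OF T(1)] by blast
    then have "\<gamma> (t + real n * T + l) = rotation a (\<gamma> (t + real n * T))"
      by (intro a(2)) simp
    then show ?thesis
      using period[of t n] period[of "t + l" n] by (simp add: ac_simps)
  qed
  have "rotation a x \<in> range \<gamma> \<longleftrightarrow> x \<in> range \<gamma>" for x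
  proof
    assume "x \<in> range \<gamma>"
    then show "rotation a x \<in> range \<gamma>" using rot by (metis rangeE rangeI)
  next
    assume "rotation a x \<in> range \<gamma>"
    then obtain t where "rotation a x = \<gamma> t" by auto
    then have "rotation a x = rotation a (\<gamma> (t - l))" using rot[of "t - l"] by simp
    then have "x = \<gamma> (t - l)" by (metis rotation_minus_cancel)
    then show "x \<in> range \<gamma>" by simp
  qed
  with a(1) show ?thesis by (rule that)
qed

section \<open>A function in the kernel of the transform\<close>

theorem proposition32:
  shows "\<exists>f :: real ^ 2 \<Rightarrow> real.
    smooth_on UNIV f \<and>
    compact (closure {x. f x \<noteq> 0}) \<and> closure {x. f x \<noteq> 0} \<subseteq> ball 0 1 \<and>
    (\<exists>x\<in>ball 0 1. f x \<noteq> 0) \<and>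
    (\<forall>\<gamma>\<in>periodic_broken_rays. periodic_broken_ray_transform f \<gamma> = 0)"
proof (intro exI[of _ odd_bump] conjI ballI)
  show "smooth_on UNIV odd_bump" by (rule smooth_odd_bump)
  have "{x. odd_bump x \<noteq> 0} \<subseteq> cball 0 (1 / 2)"
  proof clarify
    fix x assume "odd_bump x \<noteq> 0"
    then have "x \<bullet> x < 1 / 4"
      by (auto simp: odd_bump_def flat_def split: if_splits)
    then have "(norm x)\<^sup>2 < (1 / 2)\<^sup>2"
      by (simp add: power2_norm_eq_inner power_divide)
    then have "norm x < 1 / 2" by (rule power2_less_imp_less) simp
    then show "x \<in> cball 0 (1 / 2)" by simp
  qed
  then have supp: "closure {x. odd_bump x \<noteq> 0} \<subseteq> cball 0 (1 / 2)"
    by (rule closure_minimal) simp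
  then show "closure {x. odd_bump x \<noteq> 0} \<subseteq> ball 0 1" by force
  show "compact (closure {x. odd_bump x \<noteq> 0})"
    using supp bounded_subset[OF bounded_cball] by (simp add: compact_eq_bounded_closed)
  show "\<exists>x\<in>ball 0 1. odd_bump x \<noteq> 0"
  proof
    define x :: "real ^ 2" where "x = axis 1 (1 / 4)"
    show "x \<in> ball 0 1" by (simp add: x_def norm_eq_sqrt_inner inner_axis_axis real_sqrt_less_iff[of _ 1, simplified])
    show "odd_bump x \<noteq> 0"
      by (simp add: x_def odd_bump_def flat_def inner_axis_axis)
  qed
  fix \<gamma> assume "\<gamma> \<in> periodic_broken_rays"
  then obtain a where "cos a \<noteq> 1" "\<And>x. rotation a x \<in> range \<gamma> \<longleftrightarrow> x \<in> range \<gamma>"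
    using periodic_broken_ray_range_rotation by blast
  then show "periodic_broken_ray_transform odd_bump \<gamma> = 0"
    unfolding periodic_broken_ray_transform_def
    using odd_bump_rotation by (intro integral_rotation_invariant_eq_0)
qed

end
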